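(* Let $O=(0,0)$ and $P=(1,0)$. Let $B$ be a point in the first quadrant of the lemniscate $(x^2+y^2)^2=x^2-y^2$ and let $B'$ be its radial projection onto the squircle $x^4+y^4=1$. Let $C$ be the point on the first quadrant portion of the lemniscate such that $\overline{OC}=\overline{OB}^2$. Then $$l-2a\sqrt{2}=0,$$ where $l$ is the arc length of the lemniscate (along its first quadrant portion) from $C$ to $P$, and $a$ is the area of the squircular sector $OPB'$.
   Context: The first quadrant portion of the lemniscate is the curve with polar equation $r=\sqrt{\cos(2\theta)}$, $0\le\theta\le\pi/4$, running from $P=(1,0)$ (at $\theta=0$) to the origin $O$ (at $\theta=\pi/4$). $\overline{XY}$ denotes the Euclidean distance between points $X$ and $Y$. If $B$ has polar angle $\alpha\in[0,\pi/4]$ (i.e. $B$ has polar coordinates $(\sqrt{\cos 2\alpha},\alpha)$), its radial projection $B'$ onto the squircle is the point where the ray from $O$ at angle $\alpha$ meets $x^4+y^4=1$; for $B=O$ take $\alpha=\pi/4$. The squircular sector $OPB'$ is the region enclosed by the segment $OP$, the arc of the squircle from $P$ counterclockwise to $B'$, and the segment $B'O$, i.e. the region inside $x^4+y^4=1$ with polar angle between $0$ and $\alpha$. *)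

theory Defs
  imports "HOL-Analysis.Analysis"
begin

type_synonym point = "real \<times> real"

definition polar :: "real \<Rightarrow> real \<Rightarrow> point" where
  "polar r \<theta> = (r * cos \<theta>, r * sin \<theta>)"

definition first_quadrant :: "point set" where
  "first_quadrant = {(x, y). 0 \<le> x \<and> 0 \<le> y}"

definition lemniscate :: "point set" where
  "lemniscate = {(x, y). (x\<^sup>2 + y\<^sup>2)\<^sup>2 = x\<^sup>2 - y\<^sup>2}"

definition squircle :: "point set" where
  "squircle = {(x, y). x ^ 4 + y ^ 4 = 1}"

definition squircle_region :: "point set" where
  "squircle_region = {(x, y). x ^ 4 + y ^ 4 \<le> 1}"

definition lemniscate_curve :: "real \<Rightarrow> point" where
  "lemniscate_curve \<theta> = polar (sqrt (cos (2 * \<theta>))) \<theta>"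

text \<open>
  For a point of the first quadrant of the lemniscate other than the origin this is its
  ordinary polar angle; the origin gets the angle \<open>pi / 4\<close>, the only parameter in
  \<open>{0..pi/4}\<close> at which the curve passes through it. The lemmas
  \<open>lemniscate_curve_image\<close> and \<open>inj_on_lemniscate_curve\<close> below show that the description is
  proper.
\<close>

definition lemniscate_angle :: "point \<Rightarrow> real" where
  "lemniscate_angle X = (THE \<theta>. \<theta> \<in> {0..pi/4} \<and> lemniscate_curve \<theta> = X)"

definition radial_projection :: "point \<Rightarrow> point" where
  "radial_projection B =
     (THE Q. Q \<in> squircle \<and> (\<exists>\<rho>\<ge>0. Q = polar \<rho> (lemniscate_angle B)))"

definition squircular_sector :: "point \<Rightarrow> point set" where
  "squircular_sector Q =
     {polar \<rho> \<theta> | \<rho> \<theta>. 0 \<le> \<rho> \<and> 0 \<le> \<theta> \<and> \<theta> \<le> Arg (Complex (fst Q) (snd Q))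
        \<and> polar \<rho> \<theta> \<in> squircle_region}"

text \<open>
  The length of a parametrised curve is the supremum of the lengths of its inscribed
  polygonal lines. It is taken in the extended reals, so that a curve that is not rectifiable
  has length \<open>\<infinity>\<close>.
\<close>

definition curve_length :: "(real \<Rightarrow> 'a::metric_space) \<Rightarrow> real \<Rightarrow> real \<Rightarrow> ereal" where
  "curve_length c a b =
     Sup {ereal (\<Sum>i<n. dist (c (t i)) (c (t (Suc i)))) | (n::nat) (t::nat \<Rightarrow> real).
            t 0 = a \<and> t n = b \<and> (\<forall>i<n. t i \<le> t (Suc i))}"

definition lemniscate_arc_length :: "point \<Rightarrow> point \<Rightarrow> ereal" where
  "lemniscate_arc_length X Y =
     curve_length lemniscate_curve
       (min (lemniscate_angle X) (lemniscate_angle Y))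
       (max (lemniscate_angle X) (lemniscate_angle Y))"

lemma cos_double_nonneg: "\<theta> \<in> {0..pi/4} \<Longrightarrow> 0 \<le> cos (2 * \<theta>)"
  by (intro cos_ge_zero) auto

lemma inj_on_lemniscate_curve: "inj_on lemniscate_curve {0..pi/4}"
proof (rule inj_onI)
  fix s t assume s: "s \<in> {0..pi/4}" and t: "t \<in> {0..pi/4}"
    and eq: "lemniscate_curve s = lemniscate_curve t"
  have r: "(fst (lemniscate_curve u))\<^sup>2 + (snd (lemniscate_curve u))\<^sup>2 = cos (2 * u)"
    if "u \<in> {0..pi/4}" for u
    using cos_double_nonneg[OF that]
    by (simp add: lemniscate_curve_def polar_def power_mult_distrib flip: distrib_left)
  have "cos (2 * s) = cos (2 * t)"
    using r[OF s] r[OF t] eq by simp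
  then show "s = t"
    using cos_inj_pi[of "2 * s" "2 * t"] s t by auto
qed

lemma lemniscate_curve_image:
  "lemniscate_curve ` {0..pi/4} = lemniscate \<inter> first_quadrant"
proof (intro equalityI subsetI)
  fix X assume "X \<in> lemniscate_curve ` {0..pi/4}"
  then obtain t where t: "t \<in> {0..pi/4}" "X = lemniscate_curve t" by auto
  have c: "0 \<le> cos (2 * t)" by (rule cos_double_nonneg[OF t(1)])
  have "0 \<le> cos t" "0 \<le> sin t"
    using t(1) by (auto intro!: cos_ge_zero sin_ge_zero)
  moreover have "(cos (2 * t) * (cos t)\<^sup>2 + cos (2 * t) * (sin t)\<^sup>2)\<^sup>2
      = cos (2 * t) * (cos t)\<^sup>2 - cos (2 * t) * (sin t)\<^sup>2"
    by (simp add: cos_double power2_eq_square flip: distrib_left right_diff_distrib)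
  ultimately show "X \<in> lemniscate \<inter> first_quadrant"
    using c
    by (simp add: t(2) lemniscate_curve_def polar_def lemniscate_def first_quadrant_def
        power_mult_distrib)
next
  fix X assume X: "X \<in> lemniscate \<inter> first_quadrant"
  obtain x y where xy: "X = (x, y)" by (cases X)
  have l: "(x\<^sup>2 + y\<^sup>2)\<^sup>2 = x\<^sup>2 - y\<^sup>2" and nn: "0 \<le> x" "0 \<le> y"
    using X by (auto simp: xy lemniscate_def first_quadrant_def)
  show "X \<in> lemniscate_curve ` {0..pi/4}"
  proof (cases "X = (0, 0)")
    case True
    then have "X = lemniscate_curve (pi/4)"
      by (simp add: lemniscate_curve_def polar_def)
    then show ?thesis by (rule image_eqI) simp
  next
    case False
    define u where "u = x\<^sup>2 + y\<^sup>2"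
    have u: "u > 0" using False xy by (auto simp: u_def sum_power2_gt_zero_iff)
    have u2: "u\<^sup>2 = x\<^sup>2 - y\<^sup>2" using l by (simp add: u_def)
    have "u * u \<le> u * 1" using u2 by (simp add: u_def power2_eq_square)
    then have u1: "u \<le> 1" using u by simp
    define t where "t = arccos u / 2"
    have t: "t \<in> {0..pi/4}"
      using u u1 arccos_le_pi2[of u] arccos_lbound[of u] by (auto simp: t_def)
    have c2: "cos (2 * t) = u" using u u1 by (simp add: t_def)
    have ct: "0 \<le> cos t" "0 \<le> sin t"
      using t by (auto intro!: cos_ge_zero sin_ge_zero)
    have "(cos t)\<^sup>2 = (1 + u) / 2" "(sin t)\<^sup>2 = (1 - u) / 2"
      using c2 by (auto simp: cos_double sin_squared_eq)
    then have "u * (cos t)\<^sup>2 = (u + u\<^sup>2) / 2" "u * (sin t)\<^sup>2 = (u - u\<^sup>2) / 2"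
      by (simp_all only:) (simp_all add: field_simps power2_eq_square)
    then have "u * (cos t)\<^sup>2 = x\<^sup>2" "u * (sin t)\<^sup>2 = y\<^sup>2"
      unfolding u2 by (simp_all add: u_def)
    then have "(sqrt u * cos t)\<^sup>2 = x\<^sup>2" "(sqrt u * sin t)\<^sup>2 = y\<^sup>2"
      using u by (auto simp: power_mult_distrib)
    then have "sqrt u * cos t = x" "sqrt u * sin t = y"
      using u nn ct by (auto intro!: power2_eq_imp_eq)
    then have "X = lemniscate_curve t"
      by (simp add: xy lemniscate_curve_def polar_def c2)
    then show ?thesis using t by (rule image_eqI)
  qed
qed

end

theory Submission
  imports Defs
begin

text \<open>
  Let \<open>\<alpha>\<close> be the polar angle of \<open>B\<close> and \<open>R(\<theta>) = (cos\<^sup>4 \<theta> + sin\<^sup>4 \<theta>) powr (-1/4)\<close> the polar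
  radius of the squircle. The condition on \<open>C\<close> says that its polar angle \<open>\<phi>(\<alpha>)\<close> satisfies
  \<open>cos (2\<phi>(\<alpha>)) = cos\<^sup>2 (2\<alpha>)\<close>. Reparametrised by \<open>\<phi>\<close>, the lemniscate becomes a smooth curve
  with speed \<open>2 / sqrt (1 + cos\<^sup>2 (2t)) = sqrt 2 * R(t)\<^sup>2\<close>, so that \<open>l\<close> is the integral of
  \<open>sqrt 2 * R\<^sup>2\<close> over \<open>[0, \<alpha>]\<close>. The area \<open>a\<close> is the integral of \<open>R\<^sup>2 / 2\<close>: with
  \<open>(x, y) = (R cos \<alpha>, R sin \<alpha>)\<close>, slicing the sector horizontally gives
  \<open>a = (\<integral>\<^sub>0\<^sup>y (1 - s\<^sup>4) powr (1/4) ds) - x y / 2\<close>, whose derivative in \<open>\<alpha>\<close> is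
  \<open>(x y' - x' y) / 2 = R\<^sup>2 / 2\<close>.
\<close>

subsection \<open>Length of continuously differentiable curves\<close>

lemma partition_mem:
  fixes t :: "nat \<Rightarrow> real"
  assumes "\<And>i. i < n \<Longrightarrow> t i \<le> t (Suc i)" and "i \<le> n"
  shows "t i \<in> {t 0..t n}"
proof -
  have "t 0 \<le> t m" if "m \<le> n" for m
    using that by (induction m) (use assms(1) in \<open>auto intro: order_trans\<close>)
  moreover have "t i \<le> t n"
    using \<open>i \<le> n\<close> by (induction n rule: dec_induct) (use assms(1) in \<open>auto intro: order_trans\<close>)
  ultimately show ?thesis using assms(2) by auto
qed

lemma sum_integral_partition:
  fixes g :: "real \<Rightarrow> 'a::banach"
  assumes "\<And>i. i < n \<Longrightarrow> t i \<le> t (Suc i)" and "g integrable_on {t 0..t n}"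
  shows "(\<Sum>i<n. integral {t i..t (Suc i)} g) = integral {t 0..t n} g"
  using assms
proof (induction n)
  case 0
  then show ?case by simp
next
  case (Suc n)
  have le: "t 0 \<le> t n" "t n \<le> t (Suc n)"
    using partition_mem[of n t n] Suc.prems(1) by auto
  have "g integrable_on {t 0..t n}"
    by (rule integrable_subinterval_real[OF Suc.prems(2)]) (use le in auto)
  then have "(\<Sum>i<n. integral {t i..t (Suc i)} g) = integral {t 0..t n} g"
    using Suc by auto
  then show ?case
    using Henstock_Kurzweil_Integration.integral_combine[OF le Suc.prems(2)] by simp
qed

text \<open>The chord is the norm of the integral of the velocity. Summed over a partition, this
  bounds every inscribed polygon by the integral of the speed.\<close>

lemma dist_le_integral_speed:
  fixes f :: "real \<Rightarrow> 'a::banach"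
  assumes "u \<le> v"
    and f: "\<And>t. t \<in> {u..v} \<Longrightarrow> (f has_vector_derivative f' t) (at t within {u..v})"
    and cont: "continuous_on {u..v} f'"
  shows "dist (f u) (f v) \<le> integral {u..v} (\<lambda>t. norm (f' t))"
proof -
  have "(f' has_integral (f v - f u)) {u..v}"
    by (intro fundamental_theorem_of_calculus assms)
  then have "dist (f u) (f v) = norm (integral {u..v} f')"
    by (simp add: integral_unique dist_norm norm_minus_commute)
  also have "\<dots> \<le> integral {u..v} (\<lambda>t. norm (f' t))"
    by (intro Henstock_Kurzweil_Integration.integral_norm_bound_integral integrable_continuous_real
        continuous_intros cont) auto
  finally show ?thesis .
qed

text \<open>Both the chord and the integral of the speed are compared with the constant velocity
  \<open>f' u\<close>. Each comparison costs at most \<open>e * (v - u)\<close>, whence the factor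
  2.\<close>

lemma integral_speed_le_dist:
  fixes f :: "real \<Rightarrow> 'a::banach"
  assumes "u \<le> v"
    and f: "\<And>t. t \<in> {u..v} \<Longrightarrow> (f has_vector_derivative f' t) (at t within {u..v})"
    and cont: "continuous_on {u..v} f'"
    and e: "\<And>t. t \<in> {u..v} \<Longrightarrow> norm (f' t - f' u) \<le> e"
  shows "integral {u..v} (\<lambda>t. norm (f' t)) \<le> dist (f u) (f v) + 2 * e * (v - u)"
proof -
  \<comment> \<open>Mean value inequality for \<open>f\<close> minus its linearization at
    \<open>u\<close>.\<close>
  have "norm (f v - f u - (v - u) *\<^sub>R f' u) \<le> norm (v - u) * e"
    by (rule vector_differentiable_bound_linearization[of "{u..v}"])
      (use assms in \<open>auto simp: closed_segment_eq_real_ivl\<close>)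
  then have "norm (f v - f u - (v - u) *\<^sub>R f' u) \<le> (v - u) * e"
    using \<open>u \<le> v\<close> by simp
  moreover have "norm ((v - u) *\<^sub>R f' u) \<le>
      norm (f v - f u) + norm (f v - f u - (v - u) *\<^sub>R f' u)"
    by (metis norm_triangle_sub norm_minus_commute)
  ultimately have *: "(v - u) * norm (f' u) \<le> norm (f v - f u) + (v - u) * e"
    using \<open>u \<le> v\<close> by simp
  have "integral {u..v} (\<lambda>t. norm (f' t)) \<le> integral {u..v} (\<lambda>t. norm (f' u) + e)"
  proof (intro integral_le integrable_continuous_real continuous_intros cont)
    fix t assume "t \<in> {u..v}"
    then show "norm (f' t) \<le> norm (f' u) + e"
      using e[of t] norm_triangle_sub[of "f' t" "f' u"] by simp
  qed
  also have "\<dots> = (v - u) * norm (f' u) + (v - u) * e"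
    using \<open>u \<le> v\<close> by (simp add: algebra_simps)
  also have "\<dots> \<le> dist (f u) (f v) + 2 * e * (v - u)"
    using * by (simp add: dist_norm norm_minus_commute algebra_simps)
  finally show ?thesis .
qed

text \<open>Inscribed polygons never exceed the integral of the speed, and by uniform continuity of
  \<open>f'\<close> a fine enough equidistant partition comes within any \<open>e\<close> of
  it.\<close>

lemma curve_length_eq_integral:
  fixes f :: "real \<Rightarrow> 'a::banach"
  assumes "a \<le> b"
    and f: "\<And>t. t \<in> {a..b} \<Longrightarrow> (f has_vector_derivative f' t) (at t within {a..b})"
    and cont: "continuous_on {a..b} f'"
  shows "curve_length f a b = ereal (integral {a..b} (\<lambda>t. norm (f' t)))"
proof -
  let ?I = "integral {a..b} (\<lambda>t. norm (f' t))"
  have f_sub: "(f has_vector_derivative f' t) (at t within {u..v})"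
    if "{u..v} \<subseteq> {a..b}" "t \<in> {u..v}" for u v t
    using f has_vector_derivative_within_subset that by blast
  have integrable: "(\<lambda>t. norm (f' t)) integrable_on {a..b}"
    by (intro integrable_continuous_real continuous_intros cont)
  have upper: "(\<Sum>i<n. dist (f (t i)) (f (t (Suc i)))) \<le> ?I"
    if t: "t 0 = a" "t n = b" "\<forall>i<n. t i \<le> t (Suc i)" for n and t :: "nat \<Rightarrow> real"
  proof -
    have "(\<Sum>i<n. dist (f (t i)) (f (t (Suc i))))
        \<le> (\<Sum>i<n. integral {t i..t (Suc i)} (\<lambda>t. norm (f' t)))"
    proof (intro sum_mono dist_le_integral_speed)
      fix i assume i: "i \<in> {..<n}"
      then have "t i \<in> {a..b}" "t (Suc i) \<in> {a..b}"
        using partition_mem[of n t] t by auto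
      then have sub: "{t i..t (Suc i)} \<subseteq> {a..b}" by auto
      show "t i \<le> t (Suc i)" using t i by auto
      show "continuous_on {t i..t (Suc i)} f'" using continuous_on_subset[OF cont sub] .
      show "\<And>s. s \<in> {t i..t (Suc i)} \<Longrightarrow>
          (f has_vector_derivative f' s) (at s within {t i..t (Suc i)})"
        using f_sub[OF sub] .
    qed
    also have "\<dots> = ?I"
      using sum_integral_partition[of n t "\<lambda>t. norm (f' t)"] t integrable by simp
    finally show ?thesis .
  qed
  have lower: "\<exists>n t. t 0 = a \<and> t n = b \<and> (\<forall>i<n. t i \<le> t (Suc i)) \<and>
      ?I - e \<le> (\<Sum>i<n. dist (f (t i)) (f (t (Suc i))))" if "e > 0" for e
  proof -
    \<comment> \<open>The errors of all pieces add up to \<open>2 * e' * (b - a)\<close>; the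
      \<open>+ 1\<close> keeps the denominator positive when \<open>a = b\<close>.\<close>
    define e' where "e' = e / (2 * (b - a + 1))"
    have e': "e' > 0" "2 * e' * (b - a) \<le> e"
      using \<open>e > 0\<close> \<open>a \<le> b\<close> by (auto simp: e'_def field_simps)
    have "uniformly_continuous_on {a..b} f'"
      using cont compact_uniformly_continuous by blast
    then obtain d where d: "d > 0"
      "\<And>x y. \<lbrakk>x \<in> {a..b}; y \<in> {a..b}; dist y x < d\<rbrakk> \<Longrightarrow> dist (f' y) (f' x) < e'"
      using e' unfolding uniformly_continuous_on_def by metis
    \<comment> \<open>Strictness makes the mesh \<open>h\<close> smaller than \<open>d\<close> and
      keeps \<open>n\<close> positive even when \<open>a = b\<close>.\<close>
    obtain n :: nat where n: "real n > (b - a) / d"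
      using reals_Archimedean2 by blast
    moreover have "0 \<le> (b - a) / d"
      using d(1) \<open>a \<le> b\<close> by simp
    ultimately have n0: "real n > 0"
      by linarith
    define h where "h = (b - a) / n"
    have h: "0 \<le> h" "h < d" "real n * h = b - a"
      using n n0 d(1) \<open>a \<le> b\<close> by (auto simp: h_def field_simps)
    define t where "t i = a + real i * h" for i
    have t: "t 0 = a" "t n = b" "\<forall>i<n. t i \<le> t (Suc i)"
      using h by (auto simp: t_def algebra_simps)
    have diff: "t (Suc i) - t i = h" for i
      by (simp add: t_def algebra_simps)
    have "?I = (\<Sum>i<n. integral {t i..t (Suc i)} (\<lambda>t. norm (f' t)))"
      using sum_integral_partition[of n t "\<lambda>t. norm (f' t)"] t integrable by simp
    also have "\<dots> \<le> (\<Sum>i<n. dist (f (t i)) (f (t (Suc i))) + 2 * e' * (t (Suc i) - t i))"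
    proof (intro sum_mono integral_speed_le_dist)
      fix i assume i: "i \<in> {..<n}"
      then have mem: "t i \<in> {a..b}" "t (Suc i) \<in> {a..b}"
        using partition_mem[of n t] t by auto
      then have sub: "{t i..t (Suc i)} \<subseteq> {a..b}" by auto
      show "t i \<le> t (Suc i)" using t i by auto
      show "continuous_on {t i..t (Suc i)} f'" using continuous_on_subset[OF cont sub] .
      show "\<And>s. s \<in> {t i..t (Suc i)} \<Longrightarrow>
          (f has_vector_derivative f' s) (at s within {t i..t (Suc i)})"
        using f_sub[OF sub] .
      fix s assume s: "s \<in> {t i..t (Suc i)}"
      then have "dist s (t i) < d"
        using diff[of i] h by (auto simp: dist_real_def)
      then have "dist (f' s) (f' (t i)) < e'"
        using d(2) mem s sub by blast
      then show "norm (f' s - f' (t i)) \<le> e'"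
        by (simp add: dist_norm)
    qed
    also have "\<dots> = (\<Sum>i<n. dist (f (t i)) (f (t (Suc i)))) + 2 * e' * (b - a)"
      by (simp add: sum.distrib diff flip: h(3))
    finally show ?thesis
      using t e' by (intro exI[of _ n] exI[of _ t]) auto
  qed
  show ?thesis
    unfolding curve_length_def
  proof (rule Sup_eqI)
    fix y :: ereal
    assume y: "\<And>z. z \<in> {ereal (\<Sum>i<n. dist (f (t i)) (f (t (Suc i)))) | (n::nat) (t::nat \<Rightarrow> real).
            t 0 = a \<and> t n = b \<and> (\<forall>i<n. t i \<le> t (Suc i))} \<Longrightarrow> z \<le> y"
    show "ereal ?I \<le> y"
    proof (rule ereal_le_epsilon2)
      fix e :: real assume "e > 0"
      obtain n t where t: "t 0 = a" "t n = b" "\<forall>i<n. t i \<le> t (Suc i)"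
        "?I - e \<le> (\<Sum>i<n. dist (f (t i)) (f (t (Suc i))))"
        using lower[OF \<open>e > 0\<close>] by blast
      then have "ereal (\<Sum>i<n. dist (f (t i)) (f (t (Suc i)))) \<le> y"
        by (intro y) blast
      then have "ereal (?I - e) \<le> y"
        using t(4) order_trans ereal_less_eq(3) by blast
      then show "ereal ?I \<le> y + ereal e"
        by (cases y) auto
    qed
  qed (use upper in auto)
qed

text \<open>A monotone \<phi> carries a partition of \<open>{a..b}\<close> to one of
  \<open>{\<phi> a..\<phi> b}\<close> with the same chords. Monotonicity is asked rather than
  smoothness because one of the parameter changes used later has a vertical tangent at
  \<open>pi/4\<close>.\<close>

lemma curve_length_reparam_le:
  assumes "\<And>x. x \<in> {a..b} \<Longrightarrow> c (\<phi> x) = d x"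
    and mono: "\<And>x y. \<lbrakk>a \<le> x; x \<le> y; y \<le> b\<rbrakk> \<Longrightarrow> \<phi> x \<le> \<phi> y"
  shows "curve_length d a b \<le> curve_length c (\<phi> a) (\<phi> b)"
  unfolding curve_length_def
proof (rule Sup_mono, safe)
  fix n and t :: "nat \<Rightarrow> real"
  assume t: "\<forall>i<n. t i \<le> t (Suc i)" and ab: "a = t 0" "b = t n"
  have mem: "t i \<in> {a..b}" if "i \<le> n" for i
    using partition_mem[of n t i] t ab that by simp
  have "(\<Sum>i<n. dist (d (t i)) (d (t (Suc i)))) =
      (\<Sum>i<n. dist (c (\<phi> (t i))) (c (\<phi> (t (Suc i)))))"
    by (intro sum.cong refl) (use mem assms(1) in auto)
  moreover have "\<forall>i<n. \<phi> (t i) \<le> \<phi> (t (Suc i))"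
    using mem t mono by (metis Suc_leI atLeastAtMost_iff less_imp_le_nat)
  ultimately show "\<exists>y\<in>{ereal (\<Sum>i<m. dist (c (s i)) (c (s (Suc i)))) |m s.
      s 0 = \<phi> (t 0) \<and> s m = \<phi> (t n) \<and> (\<forall>i<m. s i \<le> s (Suc i))}.
      ereal (\<Sum>i<n. dist (d (t i)) (d (t (Suc i)))) \<le> y"
    by (intro bexI[of _ "ereal (\<Sum>i<n. dist (c (\<phi> (t i))) (c (\<phi> (t (Suc i)))))"])
      (auto intro!: exI[of _ n] exI[of _ "\<lambda>i. \<phi> (t i)"])
qed

subsection \<open>Area of squircular sectors\<close>

text \<open>Tonelli: the horizontal slice at height \<open>y\<close> is the interval
  \<open>{f y..g y}\<close>.\<close>

lemma measure_region_between_graphs: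
  fixes f g :: "real \<Rightarrow> real"
  assumes f: "continuous_on UNIV f" and g: "continuous_on UNIV g"
    and le: "\<And>y. y \<in> {a..b} \<Longrightarrow> f y \<le> g y"
  shows "measure lebesgue {(x, y). y \<in> {a..b} \<and> f y \<le> x \<and> x \<le> g y}
    = integral {a..b} (\<lambda>y. g y - f y)"
proof -
  let ?S = "{(x, y). y \<in> {a..b} \<and> f y \<le> x \<and> x \<le> g y}"
  let ?h = "\<lambda>y. if y \<in> {a..b} then g y - f y else 0"
  have [continuous_intros]: "continuous_on UNIV (\<lambda>p::real\<times>real. f (snd p))"
    "continuous_on UNIV (\<lambda>p::real\<times>real. g (snd p))"
    by (auto intro!: continuous_on_compose2[OF f] continuous_on_compose2[OF g] continuous_intros)
  \<comment> \<open>An intersection of closed half-spaces and regions bounded by continuous graphs,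
    hence closed and Borel.\<close>
  have "?S = {p. a \<le> snd p} \<inter> {p. snd p \<le> b} \<inter> {p. f (snd p) \<le> fst p}
      \<inter> {p. fst p \<le> g (snd p)}"
    by auto
  also have "closed \<dots>"
    by (intro closed_Int closed_Collect_le continuous_intros)
  finally have S: "?S \<in> sets borel"
    by (rule borel_closed)
  have [measurable]: "f \<in> borel_measurable borel" "g \<in> borel_measurable borel"
    using f g by (auto intro: borel_measurable_continuous_onI)
  have int: "(\<lambda>y. g y - f y) integrable_on {a..b}"
    by (intro integrable_continuous_real continuous_on_diff continuous_on_subset[OF f]
        continuous_on_subset[OF g]) auto
  have "emeasure lborel ?S = emeasure (lborel \<Otimes>\<^sub>M lborel) ?S"
    by (simp add: lborel_prod)
  also have "\<dots> = (\<integral>\<^sup>+ y. emeasure lborel ((\<lambda>x. (x, y)) -` ?S) \<partial>lborel)"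
    by (rule lborel_pair.emeasure_pair_measure_alt2) (use S in \<open>simp only: lborel_prod sets_lborel\<close>)
  also have "\<dots> = (\<integral>\<^sup>+ y. ennreal (?h y) \<partial>lborel)"
  proof (rule nn_integral_cong)
    fix y
    have "(\<lambda>x. (x, y)) -` ?S = (if y \<in> {a..b} then {f y..g y} else {})"
      by auto
    then show "emeasure lborel ((\<lambda>x. (x, y)) -` ?S) = ennreal (?h y)"
      using le[of y] by simp
  qed
  also have "\<dots> = ennreal (integral {a..b} (\<lambda>y. g y - f y))"
  proof (rule nn_integral_has_integral_lborel)
    show "?h \<in> borel_measurable borel"
      by measurable
    show "0 \<le> ?h y" for y
      using le[of y] by simp
    show "(?h has_integral integral {a..b} (\<lambda>y. g y - f y)) UNIV"
      using integrable_integral[OF int] by (simp only: has_integral_restrict_UNIV)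
  qed
  finally have "measure lborel ?S = integral {a..b} (\<lambda>y. g y - f y)"
    using integral_nonneg[OF int] le by (simp add: measure_def)
  then show ?thesis
    using S by simp
qed

section \<open>Polar radius of the squircle\<close>

definition squircle_radius :: "real \<Rightarrow> real" where
  "squircle_radius \<theta> = 1 / root 4 (cos \<theta> ^ 4 + sin \<theta> ^ 4)"

text \<open>The identity 2 (p^2 + q^2) = (p + q)^2 + (p - q)^2 for the squares p, q of cosine and
  sine. It brings in cos 2\<theta>, the quantity that governs the lemniscate.\<close>

lemma cos4_sin4: "cos \<theta> ^ 4 + sin \<theta> ^ 4 = (1 + (cos (2 * \<theta>))\<^sup>2) / (2::real)"
proof -
  have "2 * (cos \<theta> ^ 4 + sin \<theta> ^ 4)
      = ((cos \<theta>)\<^sup>2 + (sin \<theta>)\<^sup>2)\<^sup>2 + ((cos \<theta>)\<^sup>2 - (sin \<theta>)\<^sup>2)\<^sup>2"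
    by algebra
  then show ?thesis
    by (simp add: cos_double)
qed

lemma cos4_sin4_pos: "0 < cos \<theta> ^ 4 + sin \<theta> ^ (4::nat)" for \<theta> :: real
  unfolding cos4_sin4 by (simp add: add_pos_nonneg)

lemma squircle_radius_pos: "0 < squircle_radius \<theta>"
  using cos4_sin4_pos by (simp add: squircle_radius_def)

lemma squircle_radius_power4: "squircle_radius \<theta> ^ 4 * (cos \<theta> ^ 4 + sin \<theta> ^ 4) = 1"
  using cos4_sin4_pos[of \<theta>] by (simp add: squircle_radius_def power_divide)

text \<open>The form in which the radius is matched with the speed of the lemniscate.\<close>

lemma squircle_radius_square: "(squircle_radius \<theta>)\<^sup>2 = sqrt 2 / sqrt (1 + (cos (2 * \<theta>))\<^sup>2)"
proof (rule power2_eq_imp_eq)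
  have "((squircle_radius \<theta>)\<^sup>2)\<^sup>2 = squircle_radius \<theta> ^ 4"
    by (simp flip: power_mult)
  also have "\<dots> = 2 / (1 + (cos (2 * \<theta>))\<^sup>2)"
    using squircle_radius_power4[of \<theta>] unfolding cos4_sin4
    by (simp add: field_simps add_pos_nonneg add_nonneg_eq_0_iff)
  also have "\<dots> = (sqrt 2 / sqrt (1 + (cos (2 * \<theta>))\<^sup>2))\<^sup>2"
    by (simp add: power_divide add_nonneg_nonneg)
  finally show "((squircle_radius \<theta>)\<^sup>2)\<^sup>2 = (sqrt 2 / sqrt (1 + (cos (2 * \<theta>))\<^sup>2))\<^sup>2" .
qed auto

text \<open>Only existence is recorded: the derivative of the radius cancels when the sector area is
  differentiated.\<close>

lemma squircle_radius_differentiable: "\<exists>D. (squircle_radius has_real_derivative D) (at \<theta>)"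
proof -
  have "(squircle_radius has_real_derivative
      - (inverse (4 * root 4 (cos \<theta> ^ 4 + sin \<theta> ^ 4) ^ 3) *
         (4 * sin \<theta> ^ 3 * cos \<theta> - 4 * cos \<theta> ^ 3 * sin \<theta>))
      / (root 4 (cos \<theta> ^ 4 + sin \<theta> ^ 4))\<^sup>2) (at \<theta>)"
    unfolding squircle_radius_def using cos4_sin4_pos[of \<theta>]
    by (auto intro!: derivative_eq_intros DERIV_real_root
        simp: power2_eq_square field_simps)
  then show ?thesis ..
qed

text \<open>On a ray the equation of the squircle determines the fourth power of the radius, hence
  the radius. This makes the radial projection unique.\<close>

lemma polar_in_squircle_iff:
  "0 \<le> \<rho> \<Longrightarrow> polar \<rho> \<theta> \<in> squircle \<longleftrightarrow> \<rho> = squircle_radius \<theta>"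
proof -
  assume \<rho>: "0 \<le> \<rho>"
  have "polar \<rho> \<theta> \<in> squircle \<longleftrightarrow> \<rho> ^ 4 * (cos \<theta> ^ 4 + sin \<theta> ^ 4) = 1"
    by (simp add: polar_def squircle_def power_mult_distrib distrib_left)
  also have "\<dots> \<longleftrightarrow> \<rho> ^ 4 = squircle_radius \<theta> ^ 4"
    using squircle_radius_power4[of \<theta>] cos4_sin4_pos[of \<theta>]
    by (metis less_irrefl mult_right_cancel)
  also have "\<dots> \<longleftrightarrow> \<rho> = squircle_radius \<theta>"
    using \<rho> squircle_radius_pos[of \<theta>] by (intro power_eq_iff_eq_base) auto
  finally show ?thesis .
qed

lemma Arg_polar:
  assumes "0 < \<rho>" "\<theta> \<in> {-pi<..pi}"
  shows "Arg (Complex (fst (polar \<rho> \<theta>)) (snd (polar \<rho> \<theta>))) = \<theta>"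
  by (rule Arg_unique'[OF assms]) (simp add: polar_def complex_eq_iff)

text \<open>
  At \<open>\<alpha> = 0\<close> the quotient \<open>cos \<alpha> / sin \<alpha>\<close> is \<open>0\<close>, and the right-hand side is still
  correct: the segment from the origin to \<open>(1, 0)\<close>.
\<close>

lemma squircular_sector_eq:
  assumes \<alpha>: "\<alpha> \<in> {0..pi/4}"
  defines "R \<equiv> squircle_radius \<alpha>"
  shows "squircular_sector (polar R \<alpha>) =
    {(x, y). y \<in> {0..R * sin \<alpha>} \<and> y * (cos \<alpha> / sin \<alpha>) \<le> x \<and> x \<le> root 4 (1 - y ^ 4)}"
    (is "_ = ?S")
proof -
  have R: "0 < R" "R ^ 4 * (cos \<alpha> ^ 4 + sin \<alpha> ^ 4) = 1"
    by (simp_all add: R_def squircle_radius_pos squircle_radius_power4)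
  have ca: "cos \<alpha> > 0" and sa: "sin \<alpha> \<ge> 0"
    using \<alpha> pi_gt3 by (auto intro!: cos_gt_zero_pi sin_ge_zero)
  have arg: "Arg (Complex (fst (polar R \<alpha>)) (snd (polar R \<alpha>))) = \<alpha>"
    using \<alpha> R pi_gt3 by (intro Arg_polar) auto
  \<comment> \<open>\<open>root 4\<close> is strictly increasing on the whole real line, negative
    arguments included, so \<open>1 - y ^ 4\<close> may have any sign.\<close>
  have root: "x \<le> root 4 (1 - y ^ 4) \<longleftrightarrow> x ^ 4 + y ^ 4 \<le> 1" if "0 \<le> x" for x y :: real
  proof -
    have "x = root 4 (x ^ 4)"
      using that by (simp add: real_root_power_cancel)
    then have "x \<le> root 4 (1 - y ^ 4) \<longleftrightarrow> x ^ 4 \<le> 1 - y ^ 4"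
      by (metis real_root_le_iff zero_less_numeral)
    then show ?thesis by auto
  qed
  show ?thesis
    unfolding squircular_sector_def arg
  proof (intro equalityI subsetI)
    fix p
    assume "p \<in> {polar \<rho> \<theta> | \<rho> \<theta>. 0 \<le> \<rho> \<and> 0 \<le> \<theta> \<and> \<theta> \<le> \<alpha>
        \<and> polar \<rho> \<theta> \<in> squircle_region}"
    then obtain \<rho> \<theta> where \<rho>: "0 \<le> \<rho>" and \<theta>: "0 \<le> \<theta>" "\<theta> \<le> \<alpha>"
      and reg: "polar \<rho> \<theta> \<in> squircle_region" and p: "p = polar \<rho> \<theta>"
      by blast
    obtain x y where xy: "polar \<rho> \<theta> = (x, y)"
      by fastforce
    have x: "x = \<rho> * cos \<theta>" and y: "y = \<rho> * sin \<theta>"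
      using xy by (auto simp: polar_def)
    have in_reg: "x ^ 4 + y ^ 4 \<le> 1"
      using reg xy by (simp add: squircle_region_def)
    have x0: "0 \<le> x"
      unfolding x using \<rho> \<theta> \<alpha> by (intro mult_nonneg_nonneg cos_ge_zero) auto
    have y0: "0 \<le> y"
      unfolding y using \<rho> \<theta> \<alpha> by (intro mult_nonneg_nonneg sin_ge_zero) auto
    \<comment> \<open>This is the cross product of the direction at angle \<theta>, scaled by
      \<rho>, with the direction at angle \<alpha>: the point lies on or below the ray.\<close>
    have "0 \<le> \<rho> * sin (\<alpha> - \<theta>)"
      using \<rho> \<theta> \<alpha> by (intro mult_nonneg_nonneg sin_ge_zero) auto
    then have slope: "y * cos \<alpha> \<le> x * sin \<alpha>"
      by (simp add: x y sin_diff algebra_simps)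
    then have "y * (cos \<alpha> / sin \<alpha>) \<le> x"
      using sa x0 by (cases "sin \<alpha> = 0") (auto simp: field_simps)
    \<comment> \<open>A point higher than the endpoint of the arc and not left of the ray would
      exceed that endpoint in both coordinates, and so lie outside the squircle.\<close>
    moreover have "y \<le> R * sin \<alpha>"
    proof (rule ccontr)
      assume "\<not> y \<le> R * sin \<alpha>"
      then have y_gt: "R * sin \<alpha> < y" by simp
      have "sin \<alpha> \<noteq> 0"
      proof
        assume "sin \<alpha> = 0"
        then have "y \<le> 0"
          using slope ca by (simp add: mult_le_0_iff)
        then show False using y_gt \<open>sin \<alpha> = 0\<close> by simp
      qed
      have "R * sin \<alpha> * cos \<alpha> < x * sin \<alpha>"
        using y_gt ca slope by (meson less_le_trans mult_strict_right_mono)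
      then have "R * cos \<alpha> < x"
        using sa \<open>sin \<alpha> \<noteq> 0\<close> by (simp add: mult.assoc mult.commute[of "sin \<alpha>"] flip: mult.assoc)
      then have "(R * cos \<alpha>) ^ 4 + (R * sin \<alpha>) ^ 4 < x ^ 4 + y ^ 4"
        using y_gt R ca sa by (intro add_strict_mono power_strict_mono) auto
      then show False
        using R in_reg by (simp add: power_mult_distrib distrib_left)
    qed
    ultimately show "p \<in> ?S"
      using y0 x0 in_reg root by (simp add: p xy)
  next
    fix p assume "p \<in> ?S"
    then obtain x y where y: "y \<in> {0..R * sin \<alpha>}" and le: "y * (cos \<alpha> / sin \<alpha>) \<le> x"
      and x: "x \<le> root 4 (1 - y ^ 4)" and p: "p = (x, y)"
      by blast
    have "0 \<le> y * (cos \<alpha> / sin \<alpha>)"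
      using y ca sa by auto
    then have x0: "0 \<le> x" using le by linarith
    \<comment> \<open>If \<open>sin \<alpha> = 0\<close>, then \<open>le\<close> only says
      \<open>0 \<le> x\<close>, but \<open>y\<close> is confined to \<open>{0..0}\<close>.\<close>
    have slope: "y * cos \<alpha> \<le> x * sin \<alpha>"
      using le y sa by (cases "sin \<alpha> = 0") (auto simp: field_simps)
    have reg: "(x, y) \<in> squircle_region"
      using root[OF x0] x by (simp add: squircle_region_def)
    have "\<exists>\<rho> \<theta>. (x, y) = polar \<rho> \<theta> \<and> 0 \<le> \<rho> \<and> 0 \<le> \<theta> \<and> \<theta> \<le> \<alpha>
        \<and> polar \<rho> \<theta> \<in> squircle_region"
    \<comment> \<open>For \<open>x = 0\<close> the slope bound leaves only the origin, represented
      with radius 0; for \<open>x > 0\<close> the polar angle is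
      \<open>arctan (y / x)\<close>.\<close>
    proof (cases "x = 0")
      case True
      then have "y = 0" using slope ca y by (simp add: mult_le_0_iff)
      then show ?thesis using True reg \<alpha> by (intro exI[of _ 0]) (auto simp: polar_def)
    next
      case False
      then have xpos: "0 < x" using x0 by simp
      have p: "(x, y) = polar (sqrt (x\<^sup>2 + y\<^sup>2)) (arctan (y / x))"
      proof -
        have "1 + (y / x)\<^sup>2 = (x\<^sup>2 + y\<^sup>2) / x\<^sup>2"
          using xpos by (simp add: field_simps)
        then have "sqrt (1 + (y / x)\<^sup>2) = sqrt (x\<^sup>2 + y\<^sup>2) / x"
          using xpos by (simp add: real_sqrt_divide)
        moreover have "sqrt (x\<^sup>2 + y\<^sup>2) \<noteq> 0"
          using xpos by (simp add: add_pos_nonneg sum_power2_eq_zero_iff)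
        ultimately show ?thesis
          using xpos by (simp add: polar_def cos_arctan sin_arctan)
      qed
      have "y / x \<le> tan \<alpha>"
        using slope xpos ca by (simp add: tan_def field_simps)
      then have "arctan (y / x) \<le> arctan (tan \<alpha>)"
        by (simp add: arctan_le_iff)
      also have "\<dots> = \<alpha>"
        using \<alpha> pi_gt3 by (intro arctan_tan) auto
      finally have "arctan (y / x) \<le> \<alpha>" .
      moreover have "0 \<le> arctan (y / x)"
        using y xpos by simp
      ultimately show ?thesis
        using p reg by (intro exI[of _ "sqrt (x\<^sup>2 + y\<^sup>2)"] exI[of _ "arctan (y / x)"]) auto
    qed
    then show "p \<in> {polar \<rho> \<theta> | \<rho> \<theta>. 0 \<le> \<rho> \<and> 0 \<le> \<theta> \<and> \<theta> \<le> \<alpha>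
        \<and> polar \<rho> \<theta> \<in> squircle_region}"
      unfolding p by blast
  qed
qed

text \<open>Horizontal slices run from the ray to the arc, without a case split. The area between
  the y-axis and the arc is reduced by the right triangle between the y-axis and the ray.\<close>

lemma measure_squircular_sector:
  assumes \<alpha>: "\<alpha> \<in> {0..pi/4}"
  defines "R \<equiv> squircle_radius \<alpha>"
  shows "measure lebesgue (squircular_sector (polar R \<alpha>)) =
    integral {0..R * sin \<alpha>} (\<lambda>y. root 4 (1 - y ^ 4)) - (R * cos \<alpha>) * (R * sin \<alpha>) / 2"
proof -
  have R: "0 < R" "R ^ 4 * (cos \<alpha> ^ 4 + sin \<alpha> ^ 4) = 1"
    by (simp_all add: R_def squircle_radius_pos squircle_radius_power4)
  have ca: "cos \<alpha> > 0" and sa: "sin \<alpha> \<ge> 0"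
    using \<alpha> pi_gt3 by (auto intro!: cos_gt_zero_pi sin_ge_zero)
  have cont: "continuous_on A (\<lambda>y::real. root 4 (1 - y ^ 4))" for A
    by (intro continuous_intros)
  have "measure lebesgue (squircular_sector (polar R \<alpha>)) =
      integral {0..R * sin \<alpha>} (\<lambda>y. root 4 (1 - y ^ 4) - y * (cos \<alpha> / sin \<alpha>))"
    unfolding squircular_sector_eq[OF \<alpha>, folded R_def]
  proof (rule measure_region_between_graphs)
    fix y assume y: "y \<in> {0..R * sin \<alpha>}"
    \<comment> \<open>The abscissa \<open>R * cos \<alpha>\<close> of the arc's endpoint separates
      the two graphs.\<close>
    have "y * (cos \<alpha> / sin \<alpha>) \<le> R * cos \<alpha>"
      using y sa ca R by (cases "sin \<alpha> = 0") (auto simp: field_simps)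
    moreover have "R * cos \<alpha> = root 4 ((R * cos \<alpha>) ^ 4)"
      using R ca by (simp add: real_root_power_cancel)
    moreover have "(R * cos \<alpha>) ^ 4 \<le> 1 - y ^ 4"
    proof -
      have "y ^ 4 \<le> (R * sin \<alpha>) ^ 4" using y by (intro power_mono) auto
      then show ?thesis using R by (simp add: power_mult_distrib distrib_left)
    qed
    ultimately show "y * (cos \<alpha> / sin \<alpha>) \<le> root 4 (1 - y ^ 4)"
      by (metis order_trans real_root_le_iff zero_less_numeral)
  qed (intro continuous_intros cont)+
  also have "\<dots> = integral {0..R * sin \<alpha>} (\<lambda>y. root 4 (1 - y ^ 4))
      - integral {0..R * sin \<alpha>} (\<lambda>y. y * (cos \<alpha> / sin \<alpha>))"
    by (intro Henstock_Kurzweil_Integration.integral_diff integrable_continuous_real continuous_intros)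
  also have "integral {0..R * sin \<alpha>} (\<lambda>y. y * (cos \<alpha> / sin \<alpha>))
      = ((R * sin \<alpha>)\<^sup>2 - 0\<^sup>2) / 2 * (cos \<alpha> / sin \<alpha>)"
    by (intro integral_unique has_integral_mult_left ident_has_integral) (use R sa in auto)
  also have "\<dots> = (R * cos \<alpha>) * (R * sin \<alpha>) / 2"
    by (cases "sin \<alpha> = 0") (auto simp: power2_eq_square)
  finally show ?thesis .
qed

text \<open>The closed area formula is differentiated in the angle and integrated back from 0, where
  it vanishes.\<close>

lemma has_integral_measure_squircular_sector:
  assumes \<alpha>: "\<alpha> \<in> {0..pi/4}"
  shows "((\<lambda>\<theta>. (squircle_radius \<theta>)\<^sup>2 / 2) has_integral
    measure lebesgue (squircular_sector (polar (squircle_radius \<alpha>) \<alpha>))) {0..\<alpha>}"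
proof -
  let ?R = squircle_radius
  define g :: "real \<Rightarrow> real" where "g y = root 4 (1 - y ^ 4)" for y
  define A where "A \<theta> = integral {0..?R \<theta> * sin \<theta>} g - (?R \<theta> * cos \<theta>) * (?R \<theta> * sin \<theta>) / 2"
    for \<theta>
  have deriv: "(A has_real_derivative (?R \<theta>)\<^sup>2 / 2) (at \<theta> within {0..\<alpha>})"
    if \<theta>: "\<theta> \<in> {0..\<alpha>}" for \<theta>
  proof -
    obtain D where D: "(?R has_real_derivative D) (at \<theta>)"
      using squircle_radius_differentiable by blast
    have R: "0 < ?R s" "?R s ^ 4 * (cos s ^ 4 + sin s ^ 4) = 1" for s
      by (simp_all add: squircle_radius_pos squircle_radius_power4)
    have pos: "0 \<le> cos s" "0 \<le> sin s" if "s \<in> {0..\<alpha>}" for s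
      using that \<alpha> by (auto intro!: cos_ge_zero sin_ge_zero)
    have le1: "?R s * sin s \<le> 1" for s
    proof (rule ccontr)
      assume "\<not> ?R s * sin s \<le> 1"
      then have "1 < (?R s * sin s) ^ 4" by (intro one_less_power) auto
      moreover have "0 \<le> (?R s * cos s) ^ 4" by (intro zero_le_even_power) simp
      moreover have "(?R s * cos s) ^ 4 + (?R s * sin s) ^ 4 = 1"
        using R(2)[of s] by (simp add: power_mult_distrib distrib_left)
      ultimately show False by linarith
    qed
    have img: "(\<lambda>s. ?R s * sin s) ` {0..\<alpha>} \<subseteq> {0..1}"
    proof safe
      fix s assume "s \<in> {0..\<alpha>}"
      then show "?R s * sin s \<in> {0..1}"
        using le1[of s] pos[of s] R(1)[of s] by simp
    qed
    have y: "((\<lambda>s. ?R s * sin s) has_real_derivative D * sin \<theta> + ?R \<theta> * cos \<theta>)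
        (at \<theta> within {0..\<alpha>})"
      by (rule has_field_derivative_at_within)
        (auto intro!: derivative_eq_intros D simp: algebra_simps)
    have x: "((\<lambda>s. ?R s * cos s) has_real_derivative D * cos \<theta> - ?R \<theta> * sin \<theta>)
        (at \<theta> within {0..\<alpha>})"
      by (rule has_field_derivative_at_within)
        (auto intro!: derivative_eq_intros D simp: algebra_simps)
    \<comment> \<open>At \<open>\<theta> = 0\<close> the upper limit of the integral is the left end
      of \<open>{0..1}\<close>, so the chain rule is applied with derivatives within sets.\<close>
    have "continuous_on {0..1} g"
      unfolding g_def by (intro continuous_intros)
    then have "((\<lambda>y. integral {0..y} g) has_real_derivative g (?R \<theta> * sin \<theta>))
        (at (?R \<theta> * sin \<theta>) within {0..1})"
      using subsetD[OF img imageI[OF \<theta>]] by (rule integral_has_real_derivative)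
    then have "((\<lambda>y. integral {0..y} g) has_real_derivative g (?R \<theta> * sin \<theta>))
        (at (?R \<theta> * sin \<theta>) within (\<lambda>s. ?R s * sin s) ` {0..\<alpha>})"
      using img by (rule DERIV_subset)
    from DERIV_image_chain[OF this y]
    have "((\<lambda>s. integral {0..?R s * sin s} g) has_real_derivative
        g (?R \<theta> * sin \<theta>) * (D * sin \<theta> + ?R \<theta> * cos \<theta>)) (at \<theta> within {0..\<alpha>})"
      by (simp add: o_def)
    moreover have "g (?R \<theta> * sin \<theta>) = ?R \<theta> * cos \<theta>"
    proof -
      have "1 - (?R \<theta> * sin \<theta>) ^ 4 = (?R \<theta> * cos \<theta>) ^ 4"
        using R(2)[of \<theta>] by (simp add: power_mult_distrib distrib_left)
      then show ?thesis
        using R(1)[of \<theta>] pos[OF \<theta>] by (simp add: g_def real_root_power_cancel)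
    qed
    ultimately have "(A has_real_derivative
        ?R \<theta> * cos \<theta> * (D * sin \<theta> + ?R \<theta> * cos \<theta>) -
        ((D * cos \<theta> - ?R \<theta> * sin \<theta>) * (?R \<theta> * sin \<theta>)
          + (D * sin \<theta> + ?R \<theta> * cos \<theta>) * (?R \<theta> * cos \<theta>)) / 2) (at \<theta> within {0..\<alpha>})"
      unfolding A_def
      by (intro DERIV_diff DERIV_cdivide DERIV_mult x y) simp
    \<comment> \<open>All terms with \<open>D\<close> cancel; what remains is a multiple of
      \<open>s\<^sup>2 + c\<^sup>2\<close>.\<close>
    moreover have "r * c * (D * s + r * c) -
        ((D * c - r * s) * (r * s) + (D * s + r * c) * (r * c)) / 2
        = r\<^sup>2 * (s\<^sup>2 + c\<^sup>2) / 2" for r s c :: real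
      by (simp add: field_simps power2_eq_square)
    ultimately show ?thesis by simp
  qed
  have "((\<lambda>\<theta>. (?R \<theta>)\<^sup>2 / 2) has_integral A \<alpha> - A 0) {0..\<alpha>}"
    using \<alpha> deriv
    by (intro fundamental_theorem_of_calculus)
      (auto simp flip: has_real_derivative_iff_has_vector_derivative)
  moreover have "A 0 = 0" by (simp add: A_def)
  moreover have "A \<alpha> = measure lebesgue (squircular_sector (polar (?R \<alpha>) \<alpha>))"
    by (simp add: A_def g_def[abs_def] measure_squircular_sector[OF \<alpha>])
  ultimately show ?thesis by simp
qed

subsection \<open>Arc length of the lemniscate\<close>

text \<open>
  The polar angle is a singular parameter of the lemniscate at the origin. The curve below is
  the lemniscate in the parameter \<open>t\<close> with \<open>cos (2 * \<theta>) = (cos (2 * t))\<^sup>2\<close>, the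
  relation between the polar angles of \<open>C\<close> and \<open>B\<close>; it is smooth on the whole line.
\<close>

definition smooth_lemniscate :: "real \<Rightarrow> point" where
  "smooth_lemniscate t =
     (cos (2 * t) * sqrt (1 + (cos (2 * t))\<^sup>2) / sqrt 2, cos (2 * t) * sin (2 * t) / sqrt 2)"

definition smooth_angle :: "real \<Rightarrow> real" where
  "smooth_angle t = arccos ((cos (2 * t))\<^sup>2) / 2"

text \<open>Half-angle formulas for \<open>p = smooth_angle t\<close>, where cos 2p = k^2 and k =
  cos 2t. Sines and cosines are non-negative in this range, so their squares determine them, and the
  radius is k itself.\<close>

lemma lemniscate_curve_smooth_angle:
  assumes t: "t \<in> {0..pi/4}"
  shows "lemniscate_curve (smooth_angle t) = smooth_lemniscate t"
proof -
  define k where "k = cos (2 * t)"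
  have k: "0 \<le> k" "k\<^sup>2 \<le> 1"
    using cos_double_nonneg[OF t] by (auto simp: k_def abs_square_le_1)
  have k1: "-1 \<le> k\<^sup>2"
    by (rule order_trans[of _ 0]) auto
  define p where "p = smooth_angle t"
  have c2: "cos (2 * p) = k\<^sup>2"
    using k k1 by (simp add: p_def smooth_angle_def flip: k_def)
  have p: "0 \<le> p" "p \<le> pi/4"
    using k k1 arccos_le_pi2[of "k\<^sup>2"] arccos_lbound[of "k\<^sup>2"]
    by (auto simp: p_def smooth_angle_def simp flip: k_def)
  have pos: "0 \<le> cos p" "0 \<le> sin p"
    using p by (auto intro!: cos_ge_zero sin_ge_zero)
  have s: "0 \<le> sin (2 * t)"
    using t by (intro sin_ge_zero) auto
  have "(cos p)\<^sup>2 = (sqrt (1 + k\<^sup>2) / sqrt 2)\<^sup>2"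
    using c2 cos_double_cos[of p] by (simp add: power_divide)
  then have c: "cos p = sqrt (1 + k\<^sup>2) / sqrt 2"
    by (rule power2_eq_imp_eq) (simp_all add: pos)
  have "(sin p)\<^sup>2 = (sin (2 * t) / sqrt 2)\<^sup>2"
    using c2 cos_double_sin[of p] sin_squared_eq[of "2 * t"] by (simp add: power_divide k_def)
  then have "sin p = sin (2 * t) / sqrt 2"
    by (rule power2_eq_imp_eq) (simp_all add: pos s)
  then show ?thesis
    using c c2 k
    by (simp add: lemniscate_curve_def polar_def smooth_lemniscate_def flip: p_def k_def)
qed

lemma smooth_angle_mono:
  assumes "0 \<le> s" "s \<le> t" "t \<le> pi/4"
  shows "smooth_angle s \<le> smooth_angle t"
proof -
  have "cos (2 * t) \<le> cos (2 * s)"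
    using assms by (intro cos_monotone_0_pi_le) auto
  then have "(cos (2 * t))\<^sup>2 \<le> (cos (2 * s))\<^sup>2"
    using cos_double_nonneg[of t] assms by (intro power_mono) auto
  moreover have "(cos x)\<^sup>2 \<le> 1" for x :: real
    by (simp add: abs_square_le_1)
  ultimately show ?thesis
    unfolding smooth_angle_def
    by (intro divide_right_mono arccos_le_arccos) (auto intro: order_trans[of _ 0])
qed

lemma smooth_angle_inverse:
  assumes s: "s \<in> {0..pi/4}"
  defines "t \<equiv> arccos (sqrt (cos (2 * s))) / 2"
  shows "t \<in> {0..pi/4}" "smooth_angle t = s"
proof -
  have c: "0 \<le> cos (2 * s)" by (rule cos_double_nonneg[OF s])
  then have "0 \<le> sqrt (cos (2 * s))" "sqrt (cos (2 * s)) \<le> 1" "-1 \<le> sqrt (cos (2 * s))"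
    by (auto intro: order_trans[of _ 0])
  then show "t \<in> {0..pi/4}" "smooth_angle t = s"
    using arccos_le_pi2[of "sqrt (cos (2 * s))"] arccos_lbound[of "sqrt (cos (2 * s))"] c s
    by (auto simp: t_def smooth_angle_def arccos_cos)
qed

text \<open>Each curve is a monotone reparametrisation of the other, through
  \<open>smooth_angle\<close> and its inverse \<open>\<psi>\<close>, so the length inequality holds
  both ways.\<close>

lemma curve_length_smooth_lemniscate:
  assumes \<alpha>: "\<alpha> \<in> {0..pi/4}"
  shows "curve_length lemniscate_curve 0 (smooth_angle \<alpha>) = curve_length smooth_lemniscate 0 \<alpha>"
proof (rule antisym)
  define \<psi> where "\<psi> s = arccos (sqrt (cos (2 * s))) / 2" for s
  have \<phi>0: "smooth_angle 0 = 0" by (simp add: smooth_angle_def)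
  have \<phi>: "0 \<le> smooth_angle \<alpha>" "smooth_angle \<alpha> \<le> pi/4"
    using \<alpha> smooth_angle_mono[of 0 \<alpha>] smooth_angle_mono[of \<alpha> "pi/4"]
    by (auto simp: smooth_angle_def)
  have \<psi>: "\<psi> s \<in> {0..pi/4}" "smooth_angle (\<psi> s) = s" if "s \<in> {0..pi/4}" for s
    using smooth_angle_inverse[OF that] by (simp_all add: \<psi>_def)
  have "cos (2 * \<alpha>) \<ge> 0" by (rule cos_double_nonneg[OF \<alpha>])
  then have \<psi>\<alpha>: "\<psi> (smooth_angle \<alpha>) = \<alpha>"
    using \<alpha> by (simp add: \<psi>_def smooth_angle_def abs_square_le_1 cos_arccos_abs arccos_cos)
  have \<psi>0: "\<psi> 0 = 0" by (simp add: \<psi>_def)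
  have "curve_length lemniscate_curve 0 (smooth_angle \<alpha>)
      \<le> curve_length smooth_lemniscate (\<psi> 0) (\<psi> (smooth_angle \<alpha>))"
  proof (rule curve_length_reparam_le)
    fix s assume "s \<in> {0..smooth_angle \<alpha>}"
    then have s: "s \<in> {0..pi/4}" using \<phi> by auto
    show "smooth_lemniscate (\<psi> s) = lemniscate_curve s"
      using lemniscate_curve_smooth_angle[OF \<psi>(1)[OF s]] \<psi>(2)[OF s] by simp
  next
    fix x y assume xy: "0 \<le> x" "x \<le> y" "y \<le> smooth_angle \<alpha>"
    then have "cos (2 * y) \<le> cos (2 * x)" "0 \<le> cos (2 * y)"
      using \<phi> by (auto intro!: cos_monotone_0_pi_le cos_ge_zero)
    then show "\<psi> x \<le> \<psi> y"
      unfolding \<psi>_def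
      by (intro divide_right_mono arccos_le_arccos) (auto intro: order_trans[of _ 0])
  qed
  then show "curve_length lemniscate_curve 0 (smooth_angle \<alpha>) \<le> curve_length smooth_lemniscate 0 \<alpha>"
    by (simp add: \<psi>0 \<psi>\<alpha>)
  have "curve_length smooth_lemniscate 0 \<alpha>
      \<le> curve_length lemniscate_curve (smooth_angle 0) (smooth_angle \<alpha>)"
    using \<alpha>
    by (intro curve_length_reparam_le lemniscate_curve_smooth_angle smooth_angle_mono) auto
  then show "curve_length smooth_lemniscate 0 \<alpha> \<le> curve_length lemniscate_curve 0 (smooth_angle \<alpha>)"
    by (simp add: \<phi>0)
qed

section \<open>Polar angles and radial projections\<close>

lemma lemniscate_angle_curve:
  assumes "\<theta> \<in> {0..pi/4}"
  shows "lemniscate_angle (lemniscate_curve \<theta>) = \<theta>"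
  unfolding lemniscate_angle_def
  using assms by (intro the_equality) (auto dest: inj_onD[OF inj_on_lemniscate_curve])

lemma lemniscate_angle:
  assumes "X \<in> lemniscate \<inter> first_quadrant"
  shows "lemniscate_angle X \<in> {0..pi/4}" "lemniscate_curve (lemniscate_angle X) = X"
  using assms unfolding lemniscate_curve_image[symmetric] by (auto simp: lemniscate_angle_curve)

lemma dist_lemniscate_curve:
  assumes "\<theta> \<in> {0..pi/4}"
  shows "dist (0, 0) (lemniscate_curve \<theta>) = sqrt (cos (2 * \<theta>))"
  using cos_double_nonneg[OF assms]
  by (simp add: lemniscate_curve_def polar_def dist_Pair_Pair dist_real_def power_mult_distrib
      flip: distrib_left)

lemma radial_projection_eq:
  "radial_projection B = polar (squircle_radius (lemniscate_angle B)) (lemniscate_angle B)"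
  unfolding radial_projection_def
proof (rule the_equality)
  show "polar (squircle_radius (lemniscate_angle B)) (lemniscate_angle B) \<in> squircle \<and>
    (\<exists>\<rho>\<ge>0. polar (squircle_radius (lemniscate_angle B)) (lemniscate_angle B) =
       polar \<rho> (lemniscate_angle B))"
    using polar_in_squircle_iff squircle_radius_pos less_imp_le by blast
qed (auto simp: polar_in_squircle_iff)

text \<open>The speed of the smooth parametrisation is a constant multiple of the density
  \<open>(squircle_radius t)\<^sup>2 / 2\<close> of the sector area, so length and area are
  proportional.\<close>

lemma curve_length_smooth_lemniscate_eq:
  assumes \<alpha>: "\<alpha> \<in> {0..pi/4}"
  shows "curve_length smooth_lemniscate 0 \<alpha> =
    ereal (2 * sqrt 2 * measure lebesgue (squircular_sector (polar (squircle_radius \<alpha>) \<alpha>)))"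
proof -
  define v :: "real \<Rightarrow> point" where
    "v t = (- sqrt 2 * sin (2 * t) * (1 + 2 * (cos (2 * t))\<^sup>2) / sqrt (1 + (cos (2 * t))\<^sup>2),
            sqrt 2 * (2 * (cos (2 * t))\<^sup>2 - 1))" for t
  have pos: "0 < 1 + (cos t)\<^sup>2" for t :: real
    by (simp add: add_pos_nonneg)
  have v: "(smooth_lemniscate has_vector_derivative v t) (at t within {0..\<alpha>})" for t
  proof -
    define w where "w = sqrt (1 + (cos (2 * t))\<^sup>2)"
    have w: "w > 0" "w * w = 1 + (cos (2 * t))\<^sup>2"
      using pos[of "2 * t"] by (auto simp: w_def)
    have "((\<lambda>t. cos (2 * t) * sqrt (1 + (cos (2 * t))\<^sup>2) / sqrt 2) has_real_derivative
        (- (2 * sin (2 * t)) * w + cos (2 * t) * (- 2 * cos (2 * t) * sin (2 * t) / w)) / sqrt 2) (at t)"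
      using pos[of "2 * t"]
      by (intro DERIV_cdivide) (auto intro!: derivative_eq_intros simp: w_def field_simps)
    moreover have "(- (2 * sin (2 * t)) * w + cos (2 * t) * (- 2 * cos (2 * t) * sin (2 * t) / w)) / sqrt 2
        = fst (v t)"
    proof -
      have "- (2 * sin (2 * t)) * w + cos (2 * t) * (- 2 * cos (2 * t) * sin (2 * t) / w)
          = - 2 * sin (2 * t) * (w * w + (cos (2 * t))\<^sup>2) / w"
        using w(1) by (simp add: field_simps power2_eq_square)
      also have "\<dots> / sqrt 2 = - (2 / sqrt 2) * sin (2 * t) * (1 + 2 * (cos (2 * t))\<^sup>2) / w"
        unfolding w(2) by (simp add: mult.commute add.commute)
      also have "\<dots> = fst (v t)"
        by (simp add: v_def w_def real_div_sqrt)
      finally show ?thesis .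
    qed
    moreover have "((\<lambda>t. cos (2 * t) * sin (2 * t) / sqrt 2) has_real_derivative snd (v t)) (at t)"
    proof -
      have "((\<lambda>t. cos (2 * t) * sin (2 * t) / sqrt 2) has_real_derivative
          2 * ((cos (2 * t))\<^sup>2 - (sin (2 * t))\<^sup>2) / sqrt 2) (at t)"
        by (intro DERIV_cdivide)
          (auto intro!: derivative_eq_intros simp: field_simps power2_eq_square)
      moreover have "2 * ((cos (2 * t))\<^sup>2 - (sin (2 * t))\<^sup>2) / sqrt 2 = snd (v t)"
        by (simp add: v_def sin_squared_eq field_simps)
      ultimately show ?thesis by simp
    qed
    ultimately have "((\<lambda>t. (cos (2 * t) * sqrt (1 + (cos (2 * t))\<^sup>2) / sqrt 2,
        cos (2 * t) * sin (2 * t) / sqrt 2)) has_vector_derivative (fst (v t), snd (v t))) (at t)"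
      by (intro has_vector_derivative_Pair)
        (simp_all flip: has_real_derivative_iff_has_vector_derivative)
    then show ?thesis
      by (simp add: smooth_lemniscate_def[abs_def] has_vector_derivative_at_within)
  qed
  have cont: "continuous_on {0..\<alpha>} v"
    unfolding v_def using pos
    by (intro continuous_intros) (auto simp: less_imp_neq[THEN not_sym])
  have speed: "norm (v t) = 2 * sqrt 2 * ((squircle_radius t)\<^sup>2 / 2)" for t
  proof -
    define k where "k = cos (2 * t)"
    have s: "(sin (2 * t))\<^sup>2 = 1 - k\<^sup>2"
      by (simp add: k_def sin_squared_eq)
    have pk: "0 < 1 + k\<^sup>2" using pos by (simp add: k_def)
    have "(norm (v t))\<^sup>2 = (fst (v t))\<^sup>2 + (snd (v t))\<^sup>2"
      by (simp add: norm_prod_def)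
    also have "\<dots> = 2 * (1 - k\<^sup>2) * (1 + 2 * k\<^sup>2)\<^sup>2 / (1 + k\<^sup>2) + 2 * (2 * k\<^sup>2 - 1)\<^sup>2"
      using pk by (simp add: v_def power_mult_distrib power_divide s flip: k_def)
    also have "\<dots> = 4 / (1 + k\<^sup>2)"
    proof -
      \<comment> \<open>With u = k^2 the two products are twice 1 + 3u - 4u^3 and twice 1 - 3u +
        4u^3; everything but the constants cancels.\<close>
      have "2 * (1 - k\<^sup>2) * (1 + 2 * k\<^sup>2)\<^sup>2 + 2 * (2 * k\<^sup>2 - 1)\<^sup>2 * (1 + k\<^sup>2) = 4"
        by (simp add: power2_eq_square algebra_simps)
      then show ?thesis
        using pk by (simp add: divide_simps)
    qed
    also have "\<dots> = (2 / sqrt (1 + k\<^sup>2))\<^sup>2"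
      using pk by (simp add: power_divide)
    finally have "norm (v t) = 2 / sqrt (1 + k\<^sup>2)"
      by (rule power2_eq_imp_eq) (use pk in auto)
    then show ?thesis
      by (simp add: squircle_radius_square k_def)
  qed
  have "((\<lambda>t. norm (v t)) has_integral 2 * sqrt 2 *
      measure lebesgue (squircular_sector (polar (squircle_radius \<alpha>) \<alpha>))) {0..\<alpha>}"
    unfolding speed by (intro has_integral_mult_right has_integral_measure_squircular_sector \<alpha>)
  then have "integral {0..\<alpha>} (\<lambda>t. norm (v t)) =
      2 * sqrt 2 * measure lebesgue (squircular_sector (polar (squircle_radius \<alpha>) \<alpha>))"
    by (rule integral_unique)
  moreover have "curve_length smooth_lemniscate 0 \<alpha> = ereal (integral {0..\<alpha>} (\<lambda>t. norm (v t)))"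
    by (rule curve_length_eq_integral[OF _ v cont]) (use \<alpha> in auto)
  ultimately show ?thesis by simp
qed

theorem theorem1:
  fixes B B' C :: point and l :: ereal and a :: real
  assumes "B \<in> lemniscate \<inter> first_quadrant"
    and "B' = radial_projection B"
    and "C \<in> lemniscate \<inter> first_quadrant"
    and "dist (0, 0) C = (dist (0, 0) B)\<^sup>2"
    and "l = lemniscate_arc_length C (1, 0)"
    and "a = measure lebesgue (squircular_sector B')"
  shows "l - ereal (2 * a * sqrt 2) = 0"
proof -
  define \<alpha> where "\<alpha> = lemniscate_angle B"
  define \<gamma> where "\<gamma> = lemniscate_angle C"
  have \<alpha>: "\<alpha> \<in> {0..pi/4}" "lemniscate_curve \<alpha> = B"
    using lemniscate_angle[OF assms(1)] by (simp_all add: \<alpha>_def)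
  have \<gamma>: "\<gamma> \<in> {0..pi/4}" "lemniscate_curve \<gamma> = C"
    using lemniscate_angle[OF assms(3)] by (simp_all add: \<gamma>_def)
  have c: "0 \<le> cos (2 * \<alpha>)" "0 \<le> cos (2 * \<gamma>)"
    using cos_double_nonneg \<alpha> \<gamma> by auto
  have "sqrt (cos (2 * \<gamma>)) = cos (2 * \<alpha>)"
    using assms(4) dist_lemniscate_curve[OF \<alpha>(1)] dist_lemniscate_curve[OF \<gamma>(1)] \<alpha> \<gamma> c by simp
  then have "cos (2 * \<gamma>) = (cos (2 * \<alpha>))\<^sup>2"
    using c by (metis real_sqrt_pow2)
  \<comment> \<open>Since \<open>2 * \<gamma>\<close> lies in \<open>{0..pi/2}\<close>,
    \<open>arccos\<close> recovers it from its cosine.\<close>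
  then have \<gamma>_eq: "\<gamma> = smooth_angle \<alpha>"
    unfolding smooth_angle_def using arccos_cos[of "2 * \<gamma>"] \<gamma>(1) by simp
  have "lemniscate_curve 0 = (1, 0)"
    by (simp add: lemniscate_curve_def polar_def)
  then have "lemniscate_angle (1, 0) = 0"
    using lemniscate_angle_curve[of 0] by simp
  then have "l = curve_length lemniscate_curve 0 \<gamma>"
    using \<gamma>(1) by (simp add: assms(5) lemniscate_arc_length_def flip: \<gamma>_def)
  also have "\<dots> = ereal (2 * sqrt 2 * a)"
    using \<alpha>(1) by (simp add: \<gamma>_eq curve_length_smooth_lemniscate curve_length_smooth_lemniscate_eq
        assms(2,6) radial_projection_eq flip: \<alpha>_def)
  \<comment> \<open>The length has been shown to be a real number, so the difference of extended
    reals is not of the form \<infinity> - \<infinity>.\<close>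
  finally show ?thesis
    by (simp add: mult.assoc mult.commute[of a])
qed

end
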